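(* Let $Y=\{Y(x),x\ge 0\}$ be a stochastic process with values in $\mathbb{R}^d$ and let $E=\{E_t,t\ge 0\}$ be a real-valued process with $E_0=0$ and nondecreasing continuous sample functions, both defined on the same probability space and not necessarily independent. Let $X(t)=Y(E_t)$ for $t\ge 0$. Define $$D(x)=\inf\{t>0:E_t>x\},\qquad Z(x)=(D(x),Y(x)),\qquad x\ge 0,$$ where $Z=\{Z(x),x\ge0\}$ is an $\mathbb{R}^{d+1}$-valued process (in particular $D(x)<\infty$ for all $x\ge0$). Suppose that $E_1>0$ a.s. and that there exist constants $c_5$ and $c_6$ such that for all constants $0<a<\infty$ $$\dim_{\rm H}Z([0,a])=c_5\quad\text{and}\quad\dim_{\rm P}Z([0,a])=c_6\qquad\text{a.s.}$$ Then $$\dim_{\rm H}{\rm Gr}X([0,1])=\max\{1,\dim_{\rm H}Z([0,1])\}\quad\text{a.s.}$$ and $$\dim_{\rm P}{\rm Gr}X([0,1])=\max\{1,\dim_{\rm P}Z([0,1])\}\quad\text{a.s.}$$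
   Context: $\dim_{\rm H}$ and $\dim_{\rm P}$ denote Hausdorff dimension and packing dimension of subsets of Euclidean space. For a process $U$, $U([0,a])=\{U(t):t\in[0,a]\}$ is its range and ${\rm Gr}U([0,a])=\{(t,U(t)):t\in[0,a]\}$ is its graph over $[0,a]$. *)

theory Defs
  imports "HOL-Probability.Probability"
begin

section \<open>Hausdorff dimension\<close>

(* The s-th power of the diameter of a set, with the usual conventions that the empty set
   contributes 0 and that 0 ^ 0 = 1 (in Isabelle/HOL, 0 powr 0 = 0). *)
definition diam_powr :: "real \<Rightarrow> 'a::metric_space set \<Rightarrow> ennreal" where
  "diam_powr s U =
     (if U = {} then 0 else if s = 0 then 1 else ennreal (diameter U powr s))"

(* The constant diameter is only meaningful on bounded sets, hence the boundedness condition.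
   Finite covers are included, as the U i may be empty. *)
definition hausdorff_premeasure :: "real \<Rightarrow> real \<Rightarrow> 'a::metric_space set \<Rightarrow> ennreal" where
  "hausdorff_premeasure \<delta> s A =
     Inf {\<Sum>i. diam_powr s (U i) | U :: nat \<Rightarrow> 'a set.
            A \<subseteq> (\<Union>i. U i) \<and> (\<forall>i. bounded (U i) \<and> diameter (U i) \<le> \<delta>)}"

definition hausdorff_measure :: "real \<Rightarrow> 'a::metric_space set \<Rightarrow> ennreal" where
  "hausdorff_measure s A = (SUP \<delta>\<in>{0<..}. hausdorff_premeasure \<delta> s A)"

definition hausdorff_dim :: "'a::metric_space set \<Rightarrow> ereal" where
  "hausdorff_dim A = Inf {ereal s | s. 0 \<le> s \<and> hausdorff_measure s A = 0}"

section \<open>Packing dimension\<close>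

(* A packing is a countable set of pairs (centre, radius), with centres in A, radii in (0, \<delta>]
   and pairwise disjoint closed balls. *)
definition packings :: "real \<Rightarrow> 'a::euclidean_space set \<Rightarrow> ('a \<times> real) set set" where
  "packings \<delta> A =
     {P. countable P \<and> (\<forall>(x, r)\<in>P. x \<in> A \<and> 0 < r \<and> r \<le> \<delta>) \<and>
         disjoint_family_on (\<lambda>(x, r). cball x r) P}"

(* The limit as \<delta> tends to 0 is an infimum, the supremum being monotone in \<delta>;
   2 * r is the diameter of the ball of radius r. *)
definition packing_premeasure :: "real \<Rightarrow> 'a::euclidean_space set \<Rightarrow> ennreal" where
  "packing_premeasure s A =
     (INF \<delta>\<in>{0<..}. SUP P\<in>packings \<delta> A. \<Sum>\<^sub>\<infinity>(x, r)\<in>P. ennreal ((2 * r) powr s))"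

(* The packing premeasure is not countably subadditive; the packing measure is the outer
   measure obtained from it by countable decompositions. *)
definition packing_measure :: "real \<Rightarrow> 'a::euclidean_space set \<Rightarrow> ennreal" where
  "packing_measure s A =
     Inf {\<Sum>i. packing_premeasure s (B i) | B :: nat \<Rightarrow> 'a set. A \<subseteq> (\<Union>i. B i)}"

definition packing_dim :: "'a::euclidean_space set \<Rightarrow> ereal" where
  "packing_dim A = Inf {ereal s | s. 0 \<le> s \<and> packing_measure s A = 0}"

section \<open>Processes\<close>

(* Processes are functions of time and sample point; only times t \<ge> 0 are relevant. *)

definition range_over :: "(real \<Rightarrow> 'w \<Rightarrow> 'b) \<Rightarrow> real \<Rightarrow> 'w \<Rightarrow> 'b set" where
  "range_over U a \<omega> = (\<lambda>t. U t \<omega>) ` {0..a}"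

definition graph_over :: "(real \<Rightarrow> 'w \<Rightarrow> 'b) \<Rightarrow> real \<Rightarrow> 'w \<Rightarrow> (real \<times> 'b) set" where
  "graph_over U a \<omega> = (\<lambda>t. (t, U t \<omega>)) ` {0..a}"

definition time_change :: "(real \<Rightarrow> 'w \<Rightarrow> 'b) \<Rightarrow> (real \<Rightarrow> 'w \<Rightarrow> real) \<Rightarrow> real \<Rightarrow> 'w \<Rightarrow> 'b" where
  "time_change Y E t \<omega> = Y (E t \<omega>) \<omega>"

definition passage_set :: "(real \<Rightarrow> 'w \<Rightarrow> real) \<Rightarrow> real \<Rightarrow> 'w \<Rightarrow> real set" where
  "passage_set E x \<omega> = {t. 0 < t \<and> E t \<omega> > x}"

(* A real infimum: it is the intended one, and finite, exactly when the passage set is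
   nonempty. *)
definition passage_time :: "(real \<Rightarrow> 'w \<Rightarrow> real) \<Rightarrow> real \<Rightarrow> 'w \<Rightarrow> real" where
  "passage_time E x \<omega> = Inf (passage_set E x \<omega>)"

(* The product type carries the Euclidean metric, so that real \<times> (real ^ 'd) is
   Euclidean space of dimension d + 1. *)
definition passage_pair ::
  "(real \<Rightarrow> 'w \<Rightarrow> 'b) \<Rightarrow> (real \<Rightarrow> 'w \<Rightarrow> real) \<Rightarrow> real \<Rightarrow> 'w \<Rightarrow> real \<times> 'b" where
  "passage_pair Y E x \<omega> = (passage_time E x \<omega>, Y x \<omega>)"

end

theory Submission imports Defs
begin

text \<open>Since \<open>E (D x) = x\<close>, the points \<open>(D x, Y x) = (D x, X (D x))\<close> with \<open>x < E 1\<close> lie on the graph of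
  \<open>X\<close> over \<open>[0,1]\<close>. Conversely, a time \<open>t\<close> either satisfies \<open>t = D (E t)\<close>, or \<open>E\<close> is constant on an
  interval \<open>[t, r]\<close> with \<open>r\<close> rational. So the graph contains \<open>Z [0,a]\<close> for some \<open>a > 0\<close>, and is
  contained in the union of \<open>Z [0,N]\<close> for some \<open>N\<close> with countably many horizontal unit segments; by
  hypothesis \<open>Z [0,a]\<close> and \<open>Z [0,N]\<close> have the same dimension. Both dimensions are monotone and
  countably stable, at most 1 on segments, and at least 1 on a set which projects onto
  \<open>[0,1]\<close>.\<close>

section \<open>Null sets of covering constructions\<close>

text \<open>\<open>hausdorff_premeasure\<close> and \<open>packing_measure\<close> are both infima
  of this shape, with a size restriction or the trivial predicate. A cover admissible on the right
  is also admissible on the left.\<close>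

lemma Inf_cover_mono:
  fixes f :: "'a set \<Rightarrow> ennreal"
  assumes "A \<subseteq> B" "\<And>V. P V \<Longrightarrow> Q V"
  shows "Inf {\<Sum>i. f (U i) | U :: nat \<Rightarrow> 'a set. A \<subseteq> (\<Union>i. U i) \<and> (\<forall>i. Q (U i))}
    \<le> Inf {\<Sum>i. f (U i) | U :: nat \<Rightarrow> 'a set. B \<subseteq> (\<Union>i. U i) \<and> (\<forall>i. P (U i))}"
proof (rule Inf_greatest, clarify)
  fix U :: "nat \<Rightarrow> 'a set"
  assume "B \<subseteq> (\<Union>i. U i)" "\<forall>i. P (U i)"
  then have "A \<subseteq> (\<Union>i. U i) \<and> (\<forall>i. Q (U i))"
    using assms by fast
  then show "Inf {\<Sum>i. f (U i) | U :: nat \<Rightarrow> 'a set. A \<subseteq> (\<Union>i. U i) \<and> (\<forall>i. Q (U i))} \<le> (\<Sum>i. f (U i))"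
    by (intro Inf_lower CollectI exI[of _ U]) simp
qed

text \<open>Each \<open>A n\<close> has a cover of total below \<open>e / 2 ^ (n + 1)\<close>;
  together these form one countable cover of total at most \<open>e\<close>.\<close>

lemma Inf_cover_null_UN:
  fixes f :: "'a set \<Rightarrow> ennreal" and A :: "nat \<Rightarrow> 'a set"
  assumes null: "\<And>n. Inf {\<Sum>i. f (U i) | U :: nat \<Rightarrow> 'a set. A n \<subseteq> (\<Union>i. U i) \<and> (\<forall>i. P (U i))} = 0"
  shows "Inf {\<Sum>i. f (U i) | U :: nat \<Rightarrow> 'a set. (\<Union>n. A n) \<subseteq> (\<Union>i. U i) \<and> (\<forall>i. P (U i))} = 0"
    (is "Inf ?S = 0")
proof -
  have le: "Inf ?S \<le> ennreal e" if "e > 0" for e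
  proof -
    have "\<exists>U. A n \<subseteq> (\<Union>i. U i) \<and> (\<forall>i. P (U i)) \<and> (\<Sum>i. f (U i)) < ennreal (e * (1/2) ^ Suc n)" for n
    proof -
      have "Inf {\<Sum>i. f (U i) | U :: nat \<Rightarrow> 'a set. A n \<subseteq> (\<Union>i. U i) \<and> (\<forall>i. P (U i))}
          < ennreal (e * (1/2) ^ Suc n)"
        using null[of n] \<open>e > 0\<close> by simp
      then show ?thesis
        unfolding Inf_less_iff by blast
    qed
    then obtain U where U: "\<And>n. A n \<subseteq> (\<Union>i. U n i)" "\<And>n i. P (U n i)"
        "\<And>n. (\<Sum>i. f (U n i)) < ennreal (e * (1/2) ^ Suc n)"
      by metis
    \<comment> \<open>\<open>prod_decode\<close> turns the double family of covering sets into a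
      single sequence.\<close>
    define V where "V k = (case prod_decode k of (n, i) \<Rightarrow> U n i)" for k
    have V: "V (prod_encode (n, i)) = U n i" for n i
      by (simp add: V_def)
    have "(\<Union>n. A n) \<subseteq> (\<Union>k. V k)"
    proof
      fix x assume "x \<in> (\<Union>n. A n)"
      then obtain n i where "x \<in> U n i"
        using U(1) by blast
      then show "x \<in> (\<Union>k. V k)"
        using V by blast
    qed
    moreover have "P (V k)" for k
      using U(2) by (simp add: V_def split: prod.split)
    ultimately have "Inf ?S \<le> (\<Sum>k. f (V k))"
      by (intro Inf_lower) blast
    also have "(\<Sum>k. f (V k)) = (\<Sum>n. \<Sum>i. f (U n i))"
      unfolding V_def
      using suminf_ennreal_2dimen[of "\<lambda>n. \<Sum>i. f (U n i)" "\<lambda>p. f (case p of (n, i) \<Rightarrow> U n i)"]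
      by simp
    also have "\<dots> \<le> (\<Sum>n. ennreal (e * (1/2) ^ Suc n))"
      using U(3) by (intro suminf_le) (auto intro: less_imp_le)
    also have "\<dots> = ennreal (e * 1)"
      using \<open>e > 0\<close> by (intro suminf_ennreal_eq sums_mult power_half_series) auto
    finally show ?thesis
      by simp
  qed
  have "Inf ?S \<le> 0"
  proof (rule ennreal_le_epsilon)
    fix e :: real assume "0 < e"
    then show "Inf ?S \<le> 0 + ennreal e"
      unfolding add_0 by (rule le)
  qed
  then show ?thesis
    by simp
qed

section \<open>The dimension of the graph of a time-changed path\<close>

text \<open>The graph argument uses only these five properties, so it is carried out once for both
  measures. The last two leave out the exponent 1: exponents arbitrarily close to 1 already decide
  how the dimension compares with 1.\<close>

locale graph_dimension =
  fixes m :: "real \<Rightarrow> (real \<times> 'b) set \<Rightarrow> ennreal"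
  assumes antimono: "\<lbrakk>0 \<le> s; s \<le> t\<rbrakk> \<Longrightarrow> m t A \<le> m s A"
    and mono: "A \<subseteq> B \<Longrightarrow> m s A \<le> m s B"
    and null_UN: "(\<And>n. m s (C n) = 0) \<Longrightarrow> m s (\<Union>n::nat. C n) = 0"
    and null_segment: "1 < s \<Longrightarrow> m s ({0..1} \<times> {y}) = 0"
    and nonnull_projection: "\<lbrakk>0 \<le> s; s < 1; {0..1} \<subseteq> fst ` A\<rbrakk> \<Longrightarrow> m s A \<noteq> 0"
begin

definition dim :: "(real \<times> 'b) set \<Rightarrow> ereal" where
  "dim A = Inf {ereal s | s. 0 \<le> s \<and> m s A = 0}"

lemma dim_mono:
  assumes "A \<subseteq> B"
  shows "dim A \<le> dim B"
proof -
  have "m s A = 0" if "m s B = 0" for s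
    using mono[OF assms, of s] that by simp
  then show ?thesis
    unfolding dim_def by (intro Inf_superset_mono) blast
qed

lemma null_if_dim_less:
  assumes "dim A < ereal s"
  shows "m s A = 0"
proof -
  obtain t where "0 \<le> t" "m t A = 0" "t < s"
    using assms unfolding dim_def Inf_less_iff by auto
  then show ?thesis
    using antimono[of t s A] by simp
qed

lemma one_le_dim:
  assumes "{0..1} \<subseteq> fst ` A"
  shows "1 \<le> dim A"
  unfolding dim_def
proof (rule Inf_greatest, clarify)
  fix s :: real assume "0 \<le> s" "m s A = 0"
  then show "1 \<le> ereal s"
    using nonnull_projection[of s A] assms by (cases "s < 1") auto
qed

text \<open>A pathwise statement for one fixed \<open>\<omega>\<close>. The dimension is prescribed
  only for the lengths \<open>inverse (Suc n)\<close> and \<open>Suc n\<close>: countably many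
  lengths can be treated outside a single null set, and these include arbitrarily small and
  arbitrarily large ones.\<close>

lemma dim_graph_time_change:
  fixes Y :: "real \<Rightarrow> 'w \<Rightarrow> 'b" and E :: "real \<Rightarrow> 'w \<Rightarrow> real"
  assumes E0: "E 0 \<omega> = 0"
    and E_mono: "mono_on {0..} (\<lambda>t. E t \<omega>)"
    and E_cont: "continuous_on {0..} (\<lambda>t. E t \<omega>)"
    and passage: "\<And>x. 0 \<le> x \<Longrightarrow> passage_set E x \<omega> \<noteq> {}"
    and E1: "0 < E 1 \<omega>"
    and dim_small: "\<And>n::nat. dim (range_over (passage_pair Y E) (inverse (Suc n)) \<omega>) = c"
    and dim_large: "\<And>n::nat. dim (range_over (passage_pair Y E) (Suc n) \<omega>) = c"
  shows "dim (graph_over (time_change Y E) 1 \<omega>) = max 1 c"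
proof -
  let ?D = "\<lambda>x. passage_time E x \<omega>" and ?Z = "\<lambda>a. range_over (passage_pair Y E) a \<omega>"
  let ?G = "graph_over (time_change Y E) 1 \<omega>"
  have bdd: "bdd_below (passage_set E x \<omega>)" for x
    by (rule bdd_belowI[of _ 0]) (auto simp: passage_set_def)
  have E_mono': "E s \<omega> \<le> E t \<omega>" if "0 \<le> s" "s \<le> t" for s t
    using E_mono that by (auto simp: mono_on_def)
  have D_nonneg: "0 \<le> ?D x" if "0 \<le> x" for x
    unfolding passage_time_def using passage[OF that]
    by (intro cInf_greatest) (auto simp: passage_set_def)
  have D_le: "?D x \<le> t" if "0 < t" "x < E t \<omega>" for x t
    unfolding passage_time_def using that by (intro cInf_lower bdd) (auto simp: passage_set_def)
  \<comment> \<open>By monotonicity, a time at which \<open>E\<close> is at most \<open>x\<close> is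
    a lower bound of the passage set.\<close>
  have le_D: "t \<le> ?D x" if "0 \<le> t" "0 \<le> x" "E t \<omega> \<le> x" for x t
    unfolding passage_time_def
  proof (rule cInf_greatest[OF passage[OF \<open>0 \<le> x\<close>]])
    fix u assume "u \<in> passage_set E x \<omega>"
    then have "0 < u" "x < E u \<omega>"
      by (auto simp: passage_set_def)
    then show "t \<le> u"
      using that E_mono'[of u t] by linarith
  qed
  have E_D: "E (?D x) \<omega> = x" if x: "0 \<le> x" for x
  proof -
    obtain u where u: "0 < u" "x < E u \<omega>"
      using passage[OF x] by (auto simp: passage_set_def)
    \<comment> \<open>\<open>E\<close> starts at 0 and exceeds \<open>x\<close> at time
      \<open>u\<close>, so it takes the value \<open>x\<close> at some \<open>t\<close>. Then
      \<open>t\<close> is at most \<open>?D x\<close>, which bounds \<open>E (?D x)\<close> below by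
      \<open>x\<close>.\<close>
    have "\<exists>t\<ge>0. t \<le> u \<and> E t \<omega> = x"
      using u x E0 by (intro IVT' continuous_on_subset[OF E_cont]) auto
    then obtain t where t: "0 \<le> t" "E t \<omega> = x"
      by blast
    have "t \<le> ?D x"
      using t x by (intro le_D) auto
    then have "x \<le> E (?D x) \<omega>"
      using E_mono'[of t "?D x"] t by simp
    moreover have "\<not> x < E (?D x) \<omega>"
    proof
      assume less: "x < E (?D x) \<omega>"
      \<comment> \<open>At a time \<open>s\<close> where \<open>E\<close> takes the midpoint value,
        \<open>E\<close> already exceeds \<open>x\<close>, so \<open>?D x\<close> is at most
        \<open>s\<close>. This forces \<open>s = ?D x\<close>, although \<open>E\<close> is smaller
        at \<open>s\<close> than at \<open>?D x\<close>.\<close>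
      obtain s where s: "0 \<le> s" "s \<le> ?D x" "E s \<omega> = (x + E (?D x) \<omega>) / 2"
        using less x E0 D_nonneg[OF x] IVT'[of "\<lambda>t. E t \<omega>" 0 "(x + E (?D x) \<omega>) / 2" "?D x"]
          continuous_on_subset[OF E_cont] by fastforce
      have "x < E s \<omega>" "E s \<omega> < E (?D x) \<omega>"
        using less by (simp_all add: s(3))
      moreover have "s \<noteq> 0"
        using \<open>x < E s \<omega>\<close> E0 x by auto
      ultimately show False
        using D_le[of s x] s by auto
    qed
    ultimately show ?thesis
      by simp
  qed

  have "1 \<le> dim ?G"
    by (rule one_le_dim) (auto simp: graph_over_def image_image)
  moreover have "c \<le> dim ?G"
  proof -
    \<comment> \<open>With this \<open>n\<close>, every \<open>x\<close> up to
      \<open>inverse (Suc n)\<close> lies below \<open>E 1\<close>, so \<open>?D x\<close> is at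
      most 1 and, by \<open>E_D\<close>, \<open>Z x\<close> is the graph point over the time
      \<open>?D x\<close>.\<close>
    obtain n where n: "inverse (Suc n) < E 1 \<omega>"
      using reals_Archimedean[OF E1] by blast
    have "?Z (inverse (Suc n)) \<subseteq> ?G"
    proof (clarsimp simp: range_over_def)
      fix x :: real assume x: "0 \<le> x" "x \<le> inverse (1 + real n)"
      then have "?D x \<in> {0..1}"
        using D_nonneg[of x] D_le[of 1 x] n by auto
      then show "passage_pair Y E x \<omega> \<in> ?G"
        unfolding graph_over_def using E_D[OF x(1)]
        by (intro image_eqI[of _ _ "?D x"]) (auto simp: passage_pair_def time_change_def)
    qed
    from dim_mono[OF this] show ?thesis
      unfolding dim_small .
  qed
  moreover have "dim ?G \<le> max 1 c"
  \<comment> \<open>A real exponent strictly above both 1 and \<open>c\<close> makes the segments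
    and the range of \<open>Z\<close> null at the same time.\<close>
  proof (rule dense_ge)
    fix z :: ereal assume z: "max 1 c < z"
    show "dim ?G \<le> z"
    proof (cases "z = \<infinity>")
      case False
      then obtain s where s: "z = ereal s"
        using z by (cases z) auto
      then have "1 < s" "c < ereal s"
        using z by auto
      obtain n :: nat where n: "E 1 \<omega> \<le> n"
        using real_arch_simple by blast
      define q :: "nat \<Rightarrow> real" where "q = from_nat_into \<rat>"
      \<comment> \<open>The segments sit at the values of \<open>X\<close> at rational times. A
        negative rational also yields a segment, whatever \<open>E\<close> is there.\<close>
      define B where "B k = (case k of 0 \<Rightarrow> ?Z (Suc n) | Suc j \<Rightarrow> {0..1} \<times> {Y (E (q j) \<omega>) \<omega>})" for k
      have "?G \<subseteq> (\<Union>k. B k)"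
      proof (clarsimp simp: graph_over_def)
        fix t :: real assume t: "0 \<le> t" "t \<le> 1"
        define x where "x = E t \<omega>"
        have x: "0 \<le> x" "x \<le> Suc n"
          using E_mono'[of 0 t] E_mono'[of t 1] t n E0 by (auto simp: x_def)
        have "t \<le> ?D x"
          using t x by (intro le_D) (auto simp: x_def)
        show "\<exists>k. (t, time_change Y E t \<omega>) \<in> B k"
        proof (cases "t = ?D x")
          case True
          then have "(t, time_change Y E t \<omega>) \<in> ?Z (Suc n)"
            using x unfolding range_over_def
            by (intro image_eqI[of _ _ x]) (auto simp: passage_pair_def time_change_def x_def)
          then have "(t, time_change Y E t \<omega>) \<in> B 0"
            by (simp add: B_def)
          then show ?thesis ..
        next
          case False
          \<comment> \<open>\<open>E\<close> equals \<open>x\<close> at both \<open>t\<close> and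
            \<open>?D x\<close>, hence also at a rational \<open>r\<close> between them, so
            \<open>X\<close> has the same value at \<open>t\<close> and at \<open>r\<close>.\<close>
          then obtain r where r: "r \<in> \<rat>" "t < r" "r < ?D x"
            using \<open>t \<le> ?D x\<close> Rats_dense_in_real[of t "?D x"] by auto
          obtain j where j: "q j = r"
            using r(1) from_nat_into_surj[OF countable_rat] by (auto simp: q_def)
          have "E r \<omega> = x"
            using E_mono'[of t r] E_mono'[of r "?D x"] E_D[OF x(1)] t r by (auto simp: x_def)
          then have "(t, time_change Y E t \<omega>) \<in> B (Suc j)"
            using t j by (simp add: B_def time_change_def x_def)
          then show ?thesis ..
        qed
      qed
      moreover have "m s (B k) = 0" for k
        using null_if_dim_less[of "?Z (Suc n)" s] \<open>1 < s\<close> \<open>c < ereal s\<close>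
        by (auto simp: B_def null_segment dim_large split: nat.split simp del: of_nat_Suc)
      ultimately have "m s ?G = 0"
        using null_UN[of s B] mono[of ?G "\<Union>k. B k" s] by simp
      then show ?thesis
        unfolding dim_def s using \<open>1 < s\<close> by (intro Inf_lower) auto
    qed simp
  qed
  ultimately show ?thesis
    by (intro antisym) auto
qed

end

section \<open>Hausdorff measures\<close>

lemma hausdorff_premeasure_antimono_delta:
  "\<delta> \<le> \<epsilon> \<Longrightarrow> hausdorff_premeasure \<epsilon> s A \<le> hausdorff_premeasure \<delta> s A"
  unfolding hausdorff_premeasure_def by (rule Inf_cover_mono) auto

lemma hausdorff_premeasure_le_measure:
  "0 < \<delta> \<Longrightarrow> hausdorff_premeasure \<delta> s A \<le> hausdorff_measure s A"
  unfolding hausdorff_measure_def by (rule SUP_upper) simp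

text \<open>Powers of a number in [0,1] decrease in the exponent. \<open>powr_le1\<close> covers
  \<open>s = 0\<close>, where the right-hand side is 1 for nonempty \<open>U\<close> even if the
  diameter is 0.\<close>

lemma diam_powr_antimono:
  assumes "0 \<le> s" "s \<le> t" "bounded U" "diameter U \<le> 1"
  shows "diam_powr t U \<le> diam_powr s U"
  using assms powr_mono'[of s t "diameter U"] diameter_ge_0[of U] powr_le1[of t "diameter U"]
  by (auto simp: diam_powr_def ennreal_leI)

lemma hausdorff_measure_antimono:
  fixes A :: "'a::metric_space set"
  assumes "0 \<le> s" "s \<le> t"
  shows "hausdorff_measure t A \<le> hausdorff_measure s A"
  unfolding hausdorff_measure_def[of t]
proof (rule SUP_least)
  fix \<delta> :: real assume "\<delta> \<in> {0<..}"
  \<comment> \<open>Shrinking the scale to at most 1 makes \<open>diam_powr_antimono\<close>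
    applicable.\<close>
  have "hausdorff_premeasure \<delta> t A \<le> hausdorff_premeasure (min \<delta> 1) t A"
    by (rule hausdorff_premeasure_antimono_delta) simp
  also have "\<dots> \<le> hausdorff_premeasure (min \<delta> 1) s A"
    unfolding hausdorff_premeasure_def[of _ s]
  proof (rule Inf_greatest, clarify)
    fix U :: "nat \<Rightarrow> 'a set"
    assume U: "A \<subseteq> (\<Union>i. U i)" "\<forall>i. bounded (U i) \<and> diameter (U i) \<le> min \<delta> 1"
    then have "hausdorff_premeasure (min \<delta> 1) t A \<le> (\<Sum>i. diam_powr t (U i))"
      unfolding hausdorff_premeasure_def by (intro Inf_lower CollectI exI[of _ U]) simp
    also have "\<dots> \<le> (\<Sum>i. diam_powr s (U i))"
      using U(2) assms by (intro suminf_le diam_powr_antimono) auto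
    finally show "hausdorff_premeasure (min \<delta> 1) t A \<le> (\<Sum>i. diam_powr s (U i))" .
  qed
  also have "\<dots> \<le> hausdorff_measure s A"
    using \<open>\<delta> \<in> {0<..}\<close> by (intro hausdorff_premeasure_le_measure) simp
  finally show "hausdorff_premeasure \<delta> t A \<le> hausdorff_measure s A" .
qed

lemma hausdorff_measure_mono: "A \<subseteq> B \<Longrightarrow> hausdorff_measure s A \<le> hausdorff_measure s B"
  unfolding hausdorff_measure_def hausdorff_premeasure_def
  by (rule SUP_mono', rule Inf_cover_mono) auto

lemma hausdorff_measure_null_UN:
  fixes A :: "nat \<Rightarrow> 'a::metric_space set"
  assumes "\<And>n. hausdorff_measure s (A n) = 0"
  shows "hausdorff_measure s (\<Union>n. A n) = 0"
proof -
  have "hausdorff_premeasure \<delta> s (\<Union>n. A n) = 0" if "0 < \<delta>" for \<delta>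
  proof -
    have "hausdorff_premeasure \<delta> s (A n) = 0" for n
      using hausdorff_premeasure_le_measure[OF that, of s "A n"] assms by simp
    then show ?thesis
      unfolding hausdorff_premeasure_def by (rule Inf_cover_null_UN)
  qed
  then show ?thesis
    by (simp add: hausdorff_measure_def)
qed

text \<open>Cutting the segment into \<open>n\<close> pieces of length \<open>1 / n\<close> gives
  the total \<open>n * (1 / n) powr s = n powr (1 - s)\<close>, which tends to 0.\<close>

lemma hausdorff_measure_segment:
  fixes y :: "'b::metric_space"
  assumes "1 < s"
  shows "hausdorff_measure s ({0..1::real} \<times> {y}) = 0"
proof -
  have "hausdorff_premeasure \<delta> s ({0..1::real} \<times> {y}) \<le> 0" if "0 < \<delta>" for \<delta>
  proof (rule LIMSEQ_le_const)
    have "((\<lambda>n. real n powr (1 - s)) \<longlongrightarrow> 0) at_top"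
      using assms by (intro tendsto_neg_powr filterlim_real_sequentially) auto
    then show "(\<lambda>n. ennreal (real n powr (1 - s))) \<longlonglongrightarrow> 0"
      using tendsto_ennrealI by force
    obtain N :: nat where N: "inverse \<delta> < N"
      using reals_Archimedean2 by blast
    have "hausdorff_premeasure \<delta> s ({0..1::real} \<times> {y}) \<le> ennreal (real n powr (1 - s))"
      if "N \<le> n" for n
    proof -
      have n: "0 < n" "inverse n \<le> \<delta>"
      proof -
        have "inverse \<delta> < real n"
          using N that by linarith
        then show "inverse n \<le> \<delta>"
          using \<open>0 < \<delta>\<close> le_imp_inverse_le[of "inverse \<delta>" n] by simp
        show "0 < n"
          using \<open>inverse \<delta> < real n\<close> \<open>0 < \<delta>\<close> positive_imp_inverse_positive[of \<delta>] by (intro gr0I) simp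
      qed
      \<comment> \<open>The empty sets after the first \<open>n\<close> contribute 0, so the series
        becomes a finite sum.\<close>
      define U where "U i = (if i < n then {i / n..Suc i / n} \<times> {y} else {})" for i
      have U: "bounded (U i)" "diameter (U i) \<le> 1 / n" for i
      proof -
        have "dist p q \<le> 1 / n" if "p \<in> U i" "q \<in> U i" for p q
        proof -
          obtain t u where "p = (t, y)" "q = (u, y)" "t \<in> {i / n..Suc i / n}" "u \<in> {i / n..Suc i / n}"
            using \<open>p \<in> U i\<close> \<open>q \<in> U i\<close> by (auto simp: U_def split: if_splits)
          moreover have "Suc i / n = i / n + 1 / n"
            by (simp add: add_divide_distrib)
          ultimately show ?thesis
            by (simp add: dist_Pair_Pair dist_real_def abs_le_iff)
        qed
        then show "bounded (U i)" "diameter (U i) \<le> 1 / n"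
          unfolding bounded_two_points diameter_def by (blast, auto intro!: cSUP_least)
      qed
      have "\<exists>i. t \<in> {i / n..Suc i / n} \<and> i < n" if t: "0 \<le> t" "t \<le> 1" for t :: real
      \<comment> \<open>The endpoint 1 belongs to the last piece, with index \<open>n - 1\<close>;
        the floor of \<open>t * n\<close> would give \<open>n\<close> there.\<close>
      proof (cases "t = 1")
        case True
        then show ?thesis
          using n by (intro exI[of _ "n - 1"]) (simp add: of_nat_diff)
      next
        case False
        define i where "i = nat \<lfloor>t * n\<rfloor>"
        have "real i \<le> t * n" "t * n < real i + 1"
          using t by (simp_all add: i_def)
        moreover from this have "real i < n"
          using t n False mult_strict_right_mono[of t 1 n] by linarith
        ultimately show ?thesis
          using n by (intro exI[of _ i]) (simp add: field_simps)
      qed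
      then have "{0..1::real} \<times> {y} \<subseteq> (\<Union>i. U i)"
        by (force simp: U_def)
      then have "hausdorff_premeasure \<delta> s ({0..1::real} \<times> {y}) \<le> (\<Sum>i. diam_powr s (U i))"
        unfolding hausdorff_premeasure_def using U n(2)
        by (intro Inf_lower CollectI exI[of _ U]) (auto simp: inverse_eq_divide intro: order_trans)
      also have "\<dots> = (\<Sum>i<n. diam_powr s (U i))"
        by (rule suminf_finite) (auto simp: U_def diam_powr_def)
      also have "\<dots> \<le> (\<Sum>i<n. ennreal ((1 / n) powr s))"
        using U assms diameter_ge_0[OF U(1)]
        by (intro sum_mono) (auto simp: diam_powr_def intro!: ennreal_leI powr_mono2)
      also have "\<dots> = ennreal (real n powr (1 - s))"
        using n by (simp add: ennreal_of_nat_eq_real_of_nat powr_diff powr_divide flip: ennreal_mult)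
      finally show ?thesis .
    qed
    then show "\<exists>N. \<forall>n\<ge>N. hausdorff_premeasure \<delta> s ({0..1::real} \<times> {y}) \<le> ennreal (real n powr (1 - s))"
      by blast
  qed
  then show ?thesis
    by (simp add: hausdorff_measure_def)
qed

text \<open>A cover of \<open>A\<close> projects to a cover of [0,1], which has Lebesgue measure 1.
  A set of diameter \<open>d\<close> at most 1 projects into an interval of length
  \<open>2 * d\<close>, and \<open>d\<close> is at most \<open>d powr s\<close>; hence the bound
  \<open>1 / 2\<close>.\<close>

lemma hausdorff_measure_nonnull:
  fixes A :: "(real \<times> 'b::metric_space) set"
  assumes "0 \<le> s" "s \<le> 1" and A: "{0..1} \<subseteq> fst ` A"
  shows "hausdorff_measure s A \<noteq> 0"
proof -
  have "1 / 2 \<le> hausdorff_premeasure 1 s A"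
    unfolding hausdorff_premeasure_def
  proof (rule Inf_greatest, clarify)
    fix U :: "nat \<Rightarrow> (real \<times> 'b) set"
    assume U: "A \<subseteq> (\<Union>i. U i)" "\<forall>i. bounded (U i) \<and> diameter (U i) \<le> 1"
    \<comment> \<open>The projection itself may fail to be measurable, so it is enclosed in an
      interval around the projection of one of its points.\<close>
    have "\<exists>J. J \<in> sets lborel \<and> fst ` U i \<subseteq> J \<and> emeasure lborel J \<le> 2 * diam_powr s (U i)" for i
    proof (cases "U i = {}")
      case False
      then obtain p where p: "p \<in> U i"
        by blast
      let ?d = "diameter (U i)"
      have d: "0 \<le> ?d" "?d \<le> 1"
        using U by (auto intro: diameter_ge_0)
      have "fst ` U i \<subseteq> {fst p - ?d..fst p + ?d}"
      proof clarify
        fix t z assume "(t, z) \<in> U i"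
        then have "dist (t, z) p \<le> ?d"
          using p U by (intro diameter_bounded_bound) auto
        then have "dist t (fst p) \<le> ?d"
          using dist_fst_le[of "(t, z)" p] by simp
        then show "fst (t, z) \<in> {fst p - ?d..fst p + ?d}"
          by (auto simp: dist_real_def)
      qed
      moreover have "ennreal ?d \<le> diam_powr s (U i)"
        using False d assms powr_mono'[of s 1 ?d] by (auto simp: diam_powr_def intro!: ennreal_leI)
      then have "emeasure lborel {fst p - ?d..fst p + ?d} \<le> 2 * diam_powr s (U i)"
        using d by (auto simp: ennreal_mult intro!: mult_left_mono)
      ultimately show ?thesis
        by (intro exI[of _ "{fst p - ?d..fst p + ?d}"]) auto
    qed (auto intro: exI[of _ "{}"])
    then obtain J where J: "\<And>i. J i \<in> sets lborel" "\<And>i. fst ` U i \<subseteq> J i"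
      "\<And>i. emeasure lborel (J i) \<le> 2 * diam_powr s (U i)"
      by metis
    have "1 = emeasure lborel {0..1::real}"
      by simp
    also have "\<dots> \<le> emeasure lborel (\<Union>i. J i)"
      proof (rule emeasure_mono)
      show "{0..1} \<subseteq> (\<Union>i. J i)"
      proof
        fix t :: real assume "t \<in> {0..1}"
        then obtain p where p: "p \<in> A" "t = fst p"
          using A by (meson imageE subsetD)
        then obtain i where "p \<in> U i"
          using U(1) by (meson UN_E subsetD)
        then show "t \<in> (\<Union>i. J i)"
          using J(2)[of i] p(2) by (meson UN_I UNIV_I imageI subsetD)
      qed
    qed (use J(1) in auto)
    also have "\<dots> \<le> (\<Sum>i. emeasure lborel (J i))"
      using J(1) by (intro emeasure_subadditive_countably image_subsetI)
    also have "\<dots> \<le> (\<Sum>i. 2 * diam_powr s (U i))"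
      using J(3) by (intro suminf_le) auto
    also have "\<dots> = 2 * (\<Sum>i. diam_powr s (U i))"
      by simp
    finally show "1 / 2 \<le> (\<Sum>i. diam_powr s (U i))"
      by (subst divide_le_posI_ennreal) (auto simp: mult.commute)
  qed
  also have "\<dots> \<le> hausdorff_measure s A"
    by (rule hausdorff_premeasure_le_measure) simp
  finally show ?thesis
    by auto
qed

section \<open>Packing measures\<close>

lemma packing_premeasure_antimono:
  fixes A :: "'a::euclidean_space set"
  assumes "s \<le> t"
  shows "packing_premeasure t A \<le> packing_premeasure s A"
  unfolding packing_premeasure_def[of s]
proof (rule INF_greatest)
  fix \<delta> :: real assume "\<delta> \<in> {0<..}"
  \<comment> \<open>Radii up to \<open>1 / 2\<close> mean ball diameters up to 1, where larger
    exponents give smaller powers.\<close>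
  let ?\<epsilon> = "min \<delta> (1/2)"
  have "packing_premeasure t A \<le> (SUP P\<in>packings ?\<epsilon> A. \<Sum>\<^sub>\<infinity>(x, r)\<in>P. ennreal ((2 * r) powr t))"
    unfolding packing_premeasure_def using \<open>\<delta> \<in> {0<..}\<close> by (intro INF_lower) simp
  also have "\<dots> \<le> (SUP P\<in>packings \<delta> A. \<Sum>\<^sub>\<infinity>(x, r)\<in>P. ennreal ((2 * r) powr s))"
  proof (rule SUP_mono)
    fix P assume P: "P \<in> packings ?\<epsilon> A"
    then have "P \<in> packings \<delta> A"
      by (auto simp: packings_def)
    moreover have "(\<Sum>\<^sub>\<infinity>(x, r)\<in>P. ennreal ((2 * r) powr t)) \<le> (\<Sum>\<^sub>\<infinity>(x, r)\<in>P. ennreal ((2 * r) powr s))"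
    proof (rule infsum_mono)
      fix p assume "p \<in> P"
      then obtain x r where "p = (x, r)" "0 < r" "r \<le> 1/2"
        using P by (cases p) (auto simp: packings_def)
      then show "(case p of (x, r) \<Rightarrow> ennreal ((2 * r) powr t)) \<le> (case p of (x, r) \<Rightarrow> ennreal ((2 * r) powr s))"
        using assms by (simp add: ennreal_leI powr_mono')
    qed (auto intro: nonneg_summable_on_complete)
    ultimately show "\<exists>Q\<in>packings \<delta> A. (\<Sum>\<^sub>\<infinity>(x, r)\<in>P. ennreal ((2 * r) powr t))
        \<le> (\<Sum>\<^sub>\<infinity>(x, r)\<in>Q. ennreal ((2 * r) powr s))"
      by blast
  qed
  finally show "packing_premeasure t A
      \<le> (SUP P\<in>packings \<delta> A. \<Sum>\<^sub>\<infinity>(x, r)\<in>P. ennreal ((2 * r) powr s))" .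
qed

lemma packing_measure_antimono:
  fixes A :: "'a::euclidean_space set"
  assumes "s \<le> t"
  shows "packing_measure t A \<le> packing_measure s A"
  unfolding packing_measure_def[of s]
proof (rule Inf_greatest, clarify)
  fix B :: "nat \<Rightarrow> 'a set" assume "A \<subseteq> (\<Union>i. B i)"
  then have "packing_measure t A \<le> (\<Sum>i. packing_premeasure t (B i))"
    unfolding packing_measure_def by (intro Inf_lower CollectI exI[of _ B]) simp
  also have "\<dots> \<le> (\<Sum>i. packing_premeasure s (B i))"
    by (intro suminf_le packing_premeasure_antimono assms) auto
  finally show "packing_measure t A \<le> (\<Sum>i. packing_premeasure s (B i))" .
qed

lemma packing_measure_mono: "A \<subseteq> B \<Longrightarrow> packing_measure s A \<le> packing_measure s B"
  using Inf_cover_mono[of A B "\<lambda>_. True" "\<lambda>_. True" "packing_premeasure s"]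
  by (simp add: packing_measure_def)

lemma packing_measure_null_UN:
  fixes A :: "nat \<Rightarrow> 'a::euclidean_space set"
  assumes "\<And>n. packing_measure s (A n) = 0"
  shows "packing_measure s (\<Union>n. A n) = 0"
  using Inf_cover_null_UN[of "packing_premeasure s" A "\<lambda>_. True"] assms
  by (simp add: packing_measure_def)

text \<open>Disjoint balls centred on the segment cut disjoint intervals of length
  \<open>2 * r\<close> out of its line, all within [-\<delta>, 1 + \<delta>]. Splitting off the
  factor \<open>(2 * r) powr (s - 1)\<close>, at most \<open>(2 * \<delta>) powr (s - 1)\<close>,
  gives a bound that vanishes with \<delta>.\<close>

lemma packing_premeasure_segment:
  fixes y :: "'b::euclidean_space"
  assumes "1 < s"
  shows "packing_premeasure s ({0..1::real} \<times> {y}) = 0"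
proof -
  let ?A = "{0..1::real} \<times> {y}"
  have sum_le: "(\<Sum>\<^sub>\<infinity>(x, r)\<in>P. ennreal ((2 * r) powr s)) \<le> ennreal ((2 * \<delta>) powr (s - 1) * (1 + 2 * \<delta>))"
    if "0 < \<delta>" and P: "P \<in> packings \<delta> ?A" for \<delta> P
  proof (rule infsum_le_finite_sums)
    fix F assume F: "finite F" "F \<subseteq> P"
    define J :: "(real \<times> 'b) \<times> real \<Rightarrow> real set"
      where "J p = {fst (fst p) - snd p..fst (fst p) + snd p}" for p
    have FP: "0 \<le> fst (fst p)" "fst (fst p) \<le> 1" "snd (fst p) = y" "0 < snd p" "snd p \<le> \<delta>" if "p \<in> F" for p
      using that F P by (fastforce simp: packings_def)+
    have "disjoint_family_on J F"
      unfolding disjoint_family_on_def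
    proof (intro ballI impI)
      fix p q assume pq: "p \<in> F" "q \<in> F" "p \<noteq> q"
      then have disj: "cball (fst p) (snd p) \<inter> cball (fst q) (snd q) = {}"
      proof -
        have "disjoint_family_on (\<lambda>(x, r). cball x r) P" "p \<in> P" "q \<in> P"
          using P F(2) pq by (auto simp: packings_def)
        from disjoint_family_onD[OF this \<open>p \<noteq> q\<close>] show ?thesis
          by (simp add: case_prod_unfold)
      qed
      \<comment> \<open>All centres have second coordinate \<open>y\<close>, so each interval,
        placed at height \<open>y\<close>, lies in its ball and inherits disjointness.\<close>
      have "(u, y) \<in> cball (fst p) (snd p)" if "p \<in> F" "u \<in> J p" for p u
        using that FP[of p] by (cases p) (auto simp: J_def dist_Pair_Pair dist_real_def)
      then show "J p \<inter> J q = {}"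
        using disj pq by blast
    qed
    moreover have "J ` F \<subseteq> sets lborel"
      by (auto simp: J_def)
    ultimately have "(\<Sum>p\<in>F. emeasure lborel (J p)) = emeasure lborel (\<Union>p\<in>F. J p)"
      using F(1) by (intro sum_emeasure)
    also have "\<dots> \<le> emeasure lborel {-\<delta>..1 + \<delta>}"
      using FP by (intro emeasure_mono) (fastforce simp: J_def)+
    also have "\<dots> = ennreal (1 + 2 * \<delta>)"
      using \<open>0 < \<delta>\<close> by simp
    finally have *: "(\<Sum>p\<in>F. emeasure lborel (J p)) \<le> ennreal (1 + 2 * \<delta>)" .
    have "(\<Sum>(x, r)\<in>F. ennreal ((2 * r) powr s)) \<le> (\<Sum>p\<in>F. ennreal ((2 * \<delta>) powr (s - 1)) * emeasure lborel (J p))"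
    proof (rule sum_mono, clarify)
      fix t z r assume p: "((t, z), r) \<in> F"
      then have r: "0 < r" "r \<le> \<delta>"
        using FP[OF p] by auto
      have "(2 * r) powr s = (2 * r) powr (s - 1) * (2 * r)"
        using r powr_add[of "2 * r" "s - 1" 1] by simp
      also have "\<dots> \<le> (2 * \<delta>) powr (s - 1) * (2 * r)"
        using r assms by (intro mult_right_mono powr_mono2) auto
      finally show "ennreal ((2 * r) powr s) \<le> ennreal ((2 * \<delta>) powr (s - 1)) * emeasure lborel (J ((t, z), r))"
        using r by (simp add: J_def ennreal_leI flip: ennreal_mult)
    qed
    also have "\<dots> \<le> ennreal ((2 * \<delta>) powr (s - 1)) * ennreal (1 + 2 * \<delta>)"
      unfolding sum_distrib_left[symmetric] by (rule mult_left_mono[OF *]) simp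
    also have "\<dots> = ennreal ((2 * \<delta>) powr (s - 1) * (1 + 2 * \<delta>))"
      using \<open>0 < \<delta>\<close> by (simp add: ennreal_mult)
    finally show "(\<Sum>(x, r)\<in>F. ennreal ((2 * r) powr s)) \<le> \<dots>" .
  qed (auto intro: nonneg_summable_on_complete)
  have "packing_premeasure s ?A \<le> 0"
  proof (rule tendsto_lowerbound)
    have "((\<lambda>\<delta>. (2 * \<delta>) powr (s - 1) * (1 + 2 * \<delta>)) \<longlongrightarrow> (2 * 0) powr (s - 1) * (1 + 2 * 0)) (at_right 0)"
      using assms by (intro tendsto_intros tendsto_powr')
        (auto simp: eventually_at_right_less intro!: eventually_at_right_less[THEN eventually_mono])
    then show "((\<lambda>\<delta>. ennreal ((2 * \<delta>) powr (s - 1) * (1 + 2 * \<delta>))) \<longlongrightarrow> 0) (at_right 0)"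
      using tendsto_ennrealI by fastforce
    have "packing_premeasure s ?A \<le> ennreal ((2 * \<delta>) powr (s - 1) * (1 + 2 * \<delta>))" if "0 < \<delta>" for \<delta>
    proof -
      have "packing_premeasure s ?A \<le> (SUP P\<in>packings \<delta> ?A. \<Sum>\<^sub>\<infinity>(x, r)\<in>P. ennreal ((2 * r) powr s))"
        unfolding packing_premeasure_def using that by (intro INF_lower) simp
      also have "\<dots> \<le> ennreal ((2 * \<delta>) powr (s - 1) * (1 + 2 * \<delta>))"
        using sum_le[OF that] by (rule SUP_least)
      finally show ?thesis .
    qed
    then show "\<forall>\<^sub>F \<delta> in at_right 0. packing_premeasure s ?A \<le> ennreal ((2 * \<delta>) powr (s - 1) * (1 + 2 * \<delta>))"
      by (intro eventually_mono[OF eventually_at_right_less[of 0]])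
  qed simp
  then show ?thesis
    by simp
qed

lemma packing_measure_segment:
  fixes y :: "'b::euclidean_space"
  assumes "1 < s"
  shows "packing_measure s ({0..1::real} \<times> {y}) = 0"
proof -
  have "packing_measure s ({0..1::real} \<times> {y}) \<le> (\<Sum>i::nat. packing_premeasure s ({0..1::real} \<times> {y}))"
    unfolding packing_measure_def
    by (intro Inf_lower CollectI exI[of _ "\<lambda>_::nat. {0..1::real} \<times> {y}"]) simp
  then show ?thesis
    unfolding packing_premeasure_segment[OF assms] by simp
qed

text \<open>Roughly \<open>1 / \<delta>\<close> balls of radius \<open>\<delta>\<close> can be placed along the interval, and
  \<open>\<delta> powr (s - 1)\<close> tends to infinity. The balls are disjoint because their projections are.\<close>

lemma packing_premeasure_eq_top:
  fixes B :: "(real \<times> 'b::euclidean_space) set"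
  assumes "s < 1" and "a < b" and dense: "{a<..<b} \<subseteq> closure (fst ` B)"
  shows "packing_premeasure s B = top"
proof -
  have ex: "\<exists>P\<in>packings \<delta> B. ennreal K \<le> (\<Sum>\<^sub>\<infinity>(x, r)\<in>P. ennreal ((2 * r) powr s))"
    if "0 < \<delta>" for \<delta> K :: real
  proof -
    define l where "l = b - a"
    have "0 < l"
      using \<open>a < b\<close> by (simp add: l_def)
    \<comment> \<open>The right-hand side is the total of \<open>n\<close> balls of diameter
      \<open>l / (2 * n)\<close>, and it is unbounded because \<open>s < 1\<close>.\<close>
    have "\<forall>\<^sub>F n :: nat in sequentially. K \<le> real n powr (1 - s) * (l / 2) powr s"
    proof -
      have "filterlim (\<lambda>n. real n powr (1 - s) * (l / 2) powr s) at_top sequentially"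
        using assms(1) \<open>0 < l\<close>
        by (intro filterlim_at_top_mult_tendsto_pos[OF tendsto_const] 
            filterlim_compose[OF real_powr_at_top filterlim_real_sequentially]) auto
      then show ?thesis
        by (simp add: filterlim_at_top)
    qed
    moreover have "\<forall>\<^sub>F n :: nat in sequentially. l / (4 * \<delta>) \<le> n"
      by (rule eventually_ge_at_top[THEN eventually_compose_filterlim, OF filterlim_real_sequentially])
    ultimately have "\<forall>\<^sub>F n :: nat in sequentially. 
        K \<le> real n powr (1 - s) * (l / 2) powr s \<and> l / (4 * \<delta>) \<le> n \<and> 0 < n"
      using eventually_gt_at_top[of 0] by eventually_elim auto
    then obtain n :: nat where n: "K \<le> real n powr (1 - s) * (l / 2) powr s" "l / (4 * \<delta>) \<le> n" "0 < n"
      using eventually_happens'[OF sequentially_bot] by blast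
    define r where "r = l / (4 * n)"
    have r: "0 < r" "r \<le> \<delta>"
      using n \<open>0 < l\<close> \<open>0 < \<delta>\<close> by (auto simp: r_def field_simps)
    \<comment> \<open>The interval splits into \<open>n\<close> cells of length \<open>4 * r\<close>
      with left ends \<open>c k\<close>. Centres are chosen over the first halves of the cells, so
      that distinct ones are more than \<open>2 * r\<close> apart.\<close>
    define c where "c k = a + 4 * r * real k" for k :: nat
    have c_step: "c k + 4 * r \<le> c j" if "k < j" for k j
    proof -
      have "4 * r * (real k + 1) \<le> 4 * r * real j"
        using that r by (intro mult_left_mono) auto
      then show ?thesis
        by (simp add: c_def algebra_simps)
    qed
    have "\<exists>p\<in>B. c k < fst p \<and> fst p < c k + 2 * r" if "k < n" for k
    proof -
      have "c k + 4 * r \<le> c n"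
        by (rule c_step[OF that])
      also have "c n = a + l"
        using n by (simp add: c_def r_def)
      also have "\<dots> = b"
        by (simp add: l_def)
      finally have "c k + 4 * r \<le> b" .
      moreover have "a \<le> c k"
        using r by (simp add: c_def)
      ultimately have "c k + r \<in> {a<..<b}"
        using r by simp
      then have "c k + r \<in> closure (fst ` B)"
        using dense by blast
      moreover have "open {c k<..<c k + 2 * r}" "c k + r \<in> {c k<..<c k + 2 * r}"
        using r by auto
      ultimately have "{c k<..<c k + 2 * r} \<inter> fst ` B \<noteq> {}"
        using open_Int_closure_eq_empty by blast
      then show ?thesis
        by force
    qed
    then obtain p where p: "\<And>k. k < n \<Longrightarrow> p k \<in> B" "\<And>k. k < n \<Longrightarrow> c k < fst (p k)"
      "\<And>k. k < n \<Longrightarrow> fst (p k) < c k + 2 * r"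
      by metis
    have far: "2 * r < dist (p k) (p j)" if "k < j" "j < n" for k j
    proof -
      have "2 * r < fst (p j) - fst (p k)"
        using c_step[OF \<open>k < j\<close>] p(2)[of j] p(3)[of k] that by linarith
      also have "\<dots> \<le> dist (fst (p k)) (fst (p j))"
        by (simp add: dist_real_def)
      also have "\<dots> \<le> dist (p k) (p j)"
        by (rule dist_fst_le)
      finally show ?thesis .
    qed
    then have far': "2 * r < dist (p k) (p j)" if "k \<noteq> j" "k < n" "j < n" for k j
      using that by (metis dist_commute linorder_neqE_nat)
    define P where "P = (\<lambda>k. (p k, r)) ` {..<n}"
    have inj: "inj_on (\<lambda>k. (p k, r)) {..<n}"
    proof (rule inj_onI, rule ccontr)
      fix k j assume "k \<in> {..<n}" "j \<in> {..<n}" "(p k, r) = (p j, r)" "k \<noteq> j"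
      then show False
        using far'[of k j] r by simp
    qed
    have disj: "cball (p k) r \<inter> cball (p j) r = {}" if "k \<noteq> j" "k < n" "j < n" for k j
      using far'[OF that] by (intro disjoint_cballI) simp
    have "disjoint_family_on (\<lambda>(x, r). cball x r) P"
      unfolding disjoint_family_on_def P_def
    proof (intro ballI impI, elim imageE)
      fix u v k j
      assume "u \<noteq> v" "u = (p k, r)" "v = (p j, r)" "k \<in> {..<n}" "j \<in> {..<n}"
      moreover from this have "k \<noteq> j"
        by blast
      ultimately show "(case u of (x, r) \<Rightarrow> cball x r) \<inter> (case v of (x, r) \<Rightarrow> cball x r) = {}"
        using disj[of k j] by simp
    qed
    then have "P \<in> packings \<delta> B"
      using p(1) r by (auto simp: packings_def P_def)
    moreover have "ennreal K \<le> (\<Sum>\<^sub>\<infinity>(x, r)\<in>P. ennreal ((2 * r) powr s))"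
    proof -
      have "(\<Sum>\<^sub>\<infinity>(x, r)\<in>P. ennreal ((2 * r) powr s)) = (\<Sum>(x, r)\<in>P. ennreal ((2 * r) powr s))"
        by (rule infsum_finite) (simp add: P_def)
      also have "\<dots> = (\<Sum>k<n. ennreal ((2 * r) powr s))"
        unfolding P_def by (subst sum.reindex[OF inj]) simp
      also have "\<dots> = ennreal (real n * (2 * r) powr s)"
        by (simp add: ennreal_of_nat_eq_real_of_nat ennreal_mult)
      also have "2 * r = (l / 2) / n"
        by (simp add: r_def)
      also have "real n * \<dots> powr s = real n powr (1 - s) * (l / 2) powr s"
        using n \<open>0 < l\<close> by (simp add: powr_divide powr_diff powr_mult mult.commute)
      finally show ?thesis
        using n(1) by (simp add: ennreal_leI)
    qed
    ultimately show ?thesis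
      by blast
  qed
  have "(SUP P\<in>packings \<delta> B. \<Sum>\<^sub>\<infinity>(x, r)\<in>P. ennreal ((2 * r) powr s)) = top" (is "?S = top")
    if "0 < \<delta>" for \<delta>
  proof (rule ccontr)
    assume "?S \<noteq> top"
    then obtain K where K: "?S = ennreal K" "0 \<le> K"
      by (cases ?S) auto
    obtain P where "P \<in> packings \<delta> B" "ennreal (K + 1) \<le> (\<Sum>\<^sub>\<infinity>(x, r)\<in>P. ennreal ((2 * r) powr s))"
      using ex[OF \<open>0 < \<delta>\<close>] by blast
    then have "ennreal (K + 1) \<le> ?S"
      by (rule SUP_upper2)
    then show False
      using K by simp
  qed
  then show ?thesis
    by (simp add: packing_premeasure_def)
qed

text \<open>In any countable cover of \<open>A\<close>, the closures of the projections cover (0,1),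
  so one of them contains an interval. The corresponding piece has infinite premeasure; the measure
  of \<open>A\<close> is therefore even infinite.\<close>

lemma packing_measure_nonnull:
  fixes A :: "(real \<times> 'b::euclidean_space) set"
  assumes "s < 1" and A: "{0..1} \<subseteq> fst ` A"
  shows "packing_measure s A \<noteq> 0"
proof -
  have "(\<Sum>i. packing_premeasure s (B i)) = top" if B: "A \<subseteq> (\<Union>i. B i)" for B :: "nat \<Rightarrow> (real \<times> 'b) set"
  proof -
    \<comment> \<open>Baire: one of the projections is dense in some interval.\<close>
    have "\<exists>i. interior (closure (fst ` B i)) \<noteq> {}"
    proof (rule ccontr)
      assume "\<not> ?thesis"
      then have empty: "interior (closure (fst ` B i)) = {}" for i
        by blast
      have "Met_TC.mtopology interior_of (\<Union>i. closure (fst ` B i)) = {}"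
      proof (rule Met_TC.metric_Baire_category_alt)
        show "Met_TC.mcomplete TYPE(real)"
          by (simp add: mcomplete_iff_complete complete_UNIV)
        show "closedin Met_TC.mtopology T \<and> Met_TC.mtopology interior_of T = {}"
          if "T \<in> range (\<lambda>i. closure (fst ` B i))" for T
          using that empty by (auto simp: closed_closedin[symmetric])
      qed simp
      then have "interior (\<Union>i. closure (fst ` B i)) = {}"
        by simp
      moreover have "{0<..<1} \<subseteq> (\<Union>i. closure (fst ` B i))"
      proof
        fix t :: real assume "t \<in> {0<..<1}"
        then have "t \<in> {0..1}"
          by simp
        then obtain p where p: "p \<in> A" "t = fst p"
          using A by (meson imageE subsetD)
        then obtain i where "p \<in> B i"
          using B by (meson UN_E subsetD)
        then show "t \<in> (\<Union>i. closure (fst ` B i))"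
          using p(2) closure_subset by (meson UN_I UNIV_I imageI subsetD)
      qed
      then have "{0<..<1} \<subseteq> interior (\<Union>i. closure (fst ` B i))"
        by (intro interior_maximal) auto
      moreover have "1 / 2 \<in> {0<..<1::real}"
        by simp
      ultimately show False
        by blast
    qed
    then obtain i x where "x \<in> interior (closure (fst ` B i))"
      by blast
    then obtain e where "0 < e" "ball x e \<subseteq> closure (fst ` B i)"
      by (auto simp: mem_interior)
    then have "{x - e<..<x + e} \<subseteq> closure (fst ` B i)"
      by (simp add: ball_eq_greaterThanLessThan)
    then have "packing_premeasure s (B i) = top"
      using assms(1) \<open>0 < e\<close> by (intro packing_premeasure_eq_top[of s "x - e" "x + e"]) auto
    moreover have "packing_premeasure s (B i) \<le> (\<Sum>i. packing_premeasure s (B i))"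
      using sum_le_suminf[of "\<lambda>i. packing_premeasure s (B i)" "{i}"] by simp
    ultimately show ?thesis
      by (simp add: top_unique)
  qed
  then have "top \<le> packing_measure s A"
    unfolding packing_measure_def by (intro Inf_greatest) auto
  then show ?thesis
    by (auto simp: top_unique)
qed

section \<open>Time-changed processes\<close>

interpretation hausdorff: graph_dimension "hausdorff_measure :: real \<Rightarrow> (real \<times> 'b::metric_space) set \<Rightarrow> ennreal"
  rewrites "graph_dimension.dim (hausdorff_measure :: real \<Rightarrow> (real \<times> 'b) set \<Rightarrow> ennreal) = hausdorff_dim"
proof -
  show gd: "graph_dimension (hausdorff_measure :: real \<Rightarrow> (real \<times> 'b) set \<Rightarrow> ennreal)"
    by unfold_locales
      (auto simp: hausdorff_measure_nonnull intro: hausdorff_measure_antimono hausdorff_measure_mono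
        hausdorff_measure_null_UN hausdorff_measure_segment)
  show "graph_dimension.dim (hausdorff_measure :: real \<Rightarrow> (real \<times> 'b) set \<Rightarrow> ennreal) = hausdorff_dim"
    by (simp add: fun_eq_iff graph_dimension.dim_def[OF gd] hausdorff_dim_def)
qed

interpretation packing: graph_dimension "packing_measure :: real \<Rightarrow> (real \<times> 'b::euclidean_space) set \<Rightarrow> ennreal"
  rewrites "graph_dimension.dim (packing_measure :: real \<Rightarrow> (real \<times> 'b) set \<Rightarrow> ennreal) = packing_dim"
proof -
  show gd: "graph_dimension (packing_measure :: real \<Rightarrow> (real \<times> 'b) set \<Rightarrow> ennreal)"
    by unfold_locales
      (auto simp: packing_measure_nonnull intro: packing_measure_antimono packing_measure_mono
        packing_measure_null_UN packing_measure_segment)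
  show "graph_dimension.dim (packing_measure :: real \<Rightarrow> (real \<times> 'b) set \<Rightarrow> ennreal) = packing_dim"
    by (simp add: fun_eq_iff graph_dimension.dim_def[OF gd] packing_dim_def)
qed

theorem theorem2p3:
  fixes M :: "'w measure"
    and Y :: "real \<Rightarrow> 'w \<Rightarrow> real ^ 'd"
    and E :: "real \<Rightarrow> 'w \<Rightarrow> real"
    and X :: "real \<Rightarrow> 'w \<Rightarrow> real ^ 'd"
    and Z :: "real \<Rightarrow> 'w \<Rightarrow> real \<times> (real ^ 'd)"
    and c5 c6 :: real
  defines "X \<equiv> time_change Y E"
    and "Z \<equiv> passage_pair Y E"
  assumes "prob_space M"
    and "\<And>x. 0 \<le> x \<Longrightarrow> Y x \<in> borel_measurable M"
    and "\<And>t. 0 \<le> t \<Longrightarrow> E t \<in> borel_measurable M"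
    and "\<And>\<omega>. \<omega> \<in> space M \<Longrightarrow> E 0 \<omega> = 0"
    and "\<And>\<omega>. \<omega> \<in> space M \<Longrightarrow> mono_on {0..} (\<lambda>t. E t \<omega>)"
    and "\<And>\<omega>. \<omega> \<in> space M \<Longrightarrow> continuous_on {0..} (\<lambda>t. E t \<omega>)"
    and "\<And>\<omega> x. \<omega> \<in> space M \<Longrightarrow> 0 \<le> x \<Longrightarrow> passage_set E x \<omega> \<noteq> {}"
    and "AE \<omega> in M. 0 < E 1 \<omega>"
    and "\<And>a. 0 < a \<Longrightarrow> AE \<omega> in M. hausdorff_dim (range_over Z a \<omega>) = ereal c5"
    and "\<And>a. 0 < a \<Longrightarrow> AE \<omega> in M. packing_dim (range_over Z a \<omega>) = ereal c6"
  shows "(AE \<omega> in M. hausdorff_dim (graph_over X 1 \<omega>) = max 1 (hausdorff_dim (range_over Z 1 \<omega>))) \<and>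
         (AE \<omega> in M. packing_dim (graph_over X 1 \<omega>) = max 1 (packing_dim (range_over Z 1 \<omega>)))"
proof
  have small: "0 < inverse (real (Suc n))" and large: "0 < real (Suc n)" for n
    by simp_all
  \<comment> \<open>The exceptional null set depends on the length \<open>a\<close>, so only
    countably many lengths are combined.\<close>
  have "AE \<omega> in M. \<forall>n. hausdorff_dim (range_over Z (inverse (Suc n)) \<omega>) = ereal c5"
    "AE \<omega> in M. \<forall>n. hausdorff_dim (range_over Z (Suc n) \<omega>) = ereal c5"
    "AE \<omega> in M. hausdorff_dim (range_over Z 1 \<omega>) = ereal c5"
    unfolding AE_all_countable by (intro allI assms(11) small large zero_less_one)+
  then show "AE \<omega> in M. hausdorff_dim (graph_over X 1 \<omega>) = max 1 (hausdorff_dim (range_over Z 1 \<omega>))"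
    using assms(10) AE_space
  proof eventually_elim
    case (elim \<omega>)
    then show ?case
      \<comment> \<open>The dimension of the range over [0,1] is replaced by its almost sure value,
        which turns the goal into the pathwise lemma with \<open>c\<close> equal to
        \<open>c5\<close>.\<close>
      unfolding X_def Z_def elim(3)[unfolded Z_def]
      by (intro hausdorff.dim_graph_time_change assms(6-9)) blast+
  qed
  have "AE \<omega> in M. \<forall>n. packing_dim (range_over Z (inverse (Suc n)) \<omega>) = ereal c6"
    "AE \<omega> in M. \<forall>n. packing_dim (range_over Z (Suc n) \<omega>) = ereal c6"
    "AE \<omega> in M. packing_dim (range_over Z 1 \<omega>) = ereal c6"
    unfolding AE_all_countable by (intro allI assms(12) small large zero_less_one)+
  then show "AE \<omega> in M. packing_dim (graph_over X 1 \<omega>) = max 1 (packing_dim (range_over Z 1 \<omega>))"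
    using assms(10) AE_space
  proof eventually_elim
    case (elim \<omega>)
    then show ?case
      unfolding X_def Z_def elim(3)[unfolded Z_def]
      by (intro packing.dim_graph_time_change assms(6-9)) blast+
  qed
qed

end
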